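(* Let $f$ be an arithmetic function that is not identically zero, let $L$ be sufficiently large, and let $h>0$. Then for every $W>0$, \[ \left|\operatorname{Re}\frac{2}{\pi}\sum_{\substack{k\ge2,\,m\ge1\\ km\le L}}\frac{\Lambda(k)}{\sqrt k\log k}\sin\!\left(\tfrac h2\log k\right)f(m)\overline{f(km)}\right|\Big/\sum_{n\le L}|f(n)|^2 \ \le\ \max_{1\le l\le L}\left\{\frac{\sqrt W}{2}\varphi\!\left(\tfrac{h}{2\pi}\log(L/l)\right)+\frac{h\log l}{\pi\sqrt W}\right\}+O(h), \] with an absolute implied constant. In particular, for every $\xi>0$, all sufficiently large $L,T$, and every $W>0$, \[ |\tau(\xi;f)-\xi|\ \le\ \max_{1\le l\le L}\left\{\frac{\sqrt W}{2}\varphi\!\left(\xi\frac{\log(L/l)}{\log T}\right)+\frac{2\xi}{\sqrt W}\frac{\log l}{\log T}\right\}+O\!\left(\frac{\xi}{\log T}\right). \]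
   Context: $\Lambda$ is the von Mangoldt function. $\varphi(x)=\int_0^x\left(\frac{\sin(\pi u)}{\pi u}\right)^2du$. For $\xi>0$, large $T$, $L$ and an arithmetic function $f$ not identically zero on $[1,L]$, \[ \tau(\xi;f)=\xi-\left(\operatorname{Re}\frac{2}{\pi}\sum_{\substack{k\ge2,\,m\ge1\\ km\le L}}\frac{\Lambda(k)}{\sqrt k\log k}\sin\!\left(\pi\xi\tfrac{\log k}{\log T}\right)f(m)\overline{f(km)}\Big/\sum_{n\le L}|f(n)|^2\right). \] *)

theory Defs
  imports "HOL-Analysis.Analysis" "HOL-Number_Theory.Prime_Powers"
begin

text \<open>The integrand takes the value \<open>0\<close> instead of \<open>1\<close> at \<open>u = 0\<close> because \<open>0 / 0 = 0\<close>;
  this does not affect the integral.\<close>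

definition phi :: "real \<Rightarrow> real" where
  "phi x = (LBINT u=ereal 0..ereal x. (sin (pi * u) / (pi * u))\<^sup>2)"

text \<open>Arithmetic functions are functions on \<^typ>\<open>nat\<close> whose value at \<open>0\<close> is never used.\<close>

definition mass :: "(nat \<Rightarrow> complex) \<Rightarrow> real \<Rightarrow> real" where
  "mass f L = (\<Sum>n | 1 \<le> n \<and> real n \<le> L. (cmod (f n))\<^sup>2)"

definition mangoldt_sum :: "real \<Rightarrow> (nat \<Rightarrow> complex) \<Rightarrow> real \<Rightarrow> complex" where
  "mangoldt_sum \<theta> f L =
     (\<Sum>(k, m) | 2 \<le> k \<and> 1 \<le> m \<and> real (k * m) \<le> L.
        complex_of_real (mangoldt k / (sqrt (real k) * ln (real k)) * sin (\<theta> * ln (real k)))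
          * f m * cnj (f (k * m)))"

definition tau :: "real \<Rightarrow> real \<Rightarrow> real \<Rightarrow> (nat \<Rightarrow> complex) \<Rightarrow> real" where
  "tau T L \<xi> f =
     \<xi> - Re (complex_of_real (2 / pi) * mangoldt_sum (pi * \<xi> / ln T) f L) / mass f L"

end

theory Submission
  imports Defs "HOL-Probability.Sinc_Integral"
begin

text \<open>
  Bound the bilinear sum by absolute values. For \<open>k\<close> below an absolute constant \<open>K\<close>, the unweighted
  inequality \<open>2|xy| \<le> x\<^sup>2 + y\<^sup>2\<close> costs only \<open>O(h)\<close>. For \<open>k > K\<close> apply
  \<open>2|xy| \<le> w x\<^sup>2 + y\<^sup>2 / w\<close> with weight proportional to
  \<open>\<surd>W |sin (h/2 ln k)| / (h \<surd>k ln k)\<close>. The coefficient of \<open>|f(l)|\<^sup>2\<close> is then a sum of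
  \<open>\<Lambda>(k)\<close> over divisors of \<open>l\<close>, which is at most \<open>ln l\<close>, plus a sum
  \<open>\<Sum> \<Lambda>(k)/k (sin (h/2 ln k) / ln k)\<^sup>2\<close> over \<open>K < k \<le> L/l\<close>. By Mertens' theorem the
  latter is comparable to an integral that equals \<open>pi h / 2 * phi (h / (2 pi) ln (L/l))\<close>. An error
  here would be multiplied by \<open>\<surd>W\<close>, so none can be afforded; it is absorbed by the part of the
  integral over \<open>[0, ln K]\<close>, which the omitted small \<open>k\<close> leave unused.
\<close>

section \<open>Chebyshev's and Mertens' estimates\<close>

text \<open>Legendre's formula in logarithmic form. From \<open>n\<close> to \<open>n + 1\<close>
  the quotient \<open>n div k\<close> grows by one exactly when \<open>k\<close> divides
  \<open>n + 1\<close>, and the von Mangoldt function sums to \<open>ln (n + 1)\<close> over these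
  divisors.\<close>

lemma ln_fact_eq_sum_mangoldt:
  "ln (fact n :: real) = (\<Sum>k=1..n. mangoldt k * real (n div k))"
proof (induction n)
  case (Suc n)
  have eq: "mangoldt k * real (Suc n div k)
      = mangoldt k * real (n div k) + (if k dvd Suc n then mangoldt k else 0)" for k
    by (simp add: div_Suc algebra_simps dvd_eq_mod_eq_0)
  have "(\<Sum>k=1..Suc n. mangoldt k * real (Suc n div k))
      = (\<Sum>k=1..Suc n. mangoldt k * real (n div k)) + (\<Sum>k=1..Suc n. if k dvd Suc n then mangoldt k else 0)"
    by (simp only: eq sum.distrib)
  also have "(\<Sum>k=1..Suc n. mangoldt k * real (n div k)) = ln (fact n :: real)"
    using Suc.IH by simp
  also have "(\<Sum>k=1..Suc n. if k dvd Suc n then mangoldt k else 0) = (\<Sum>k | k dvd Suc n. mangoldt k :: real)"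
  proof -
    have "{k \<in> {1..Suc n}. k dvd Suc n} = {k. k dvd Suc n}"
      by (auto dest: dvd_imp_le intro!: Suc_leI dvd_pos_nat[of "Suc n"])
    moreover have "(\<Sum>k=1..Suc n. if k dvd Suc n then mangoldt k else 0)
        = (\<Sum>k | k \<in> {1..Suc n} \<and> k dvd Suc n. mangoldt k :: real)"
      by (rule sum.inter_filter[symmetric]) simp
    ultimately show ?thesis by (simp only:)
  qed
  also have "\<dots> = ln (real (Suc n))"
    using mangoldt_sum[of "Suc n", where ?'a = real] by simp
  finally show ?case
    by (simp add: ln_mult)
qed simp

text \<open>Chebyshev's argument: in the logarithm of the central binomial coefficient, which is at
  most \<open>4 ^ n\<close>, \<open>mangoldt k\<close> has the coefficient
  \<open>2 * n div k - 2 * (n div k)\<close>. It is never negative, and it is at least 1 for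
  \<open>n < k \<le> 2 * n\<close>.\<close>

lemma sum_mangoldt_double_le:
  "(\<Sum>k=1..2 * n. mangoldt k :: real) \<le> (\<Sum>k=1..n. mangoldt k) + 2 * real n * ln 2"
proof -
  have "fact (2 * n) = (fact n * fact n * of_nat (2 * n choose n) :: real)"
    using binomial_fact_lemma[of n "2 * n"] by (metis (no_types, lifting) le_add1 mult_2 add_diff_cancel_left' of_nat_fact of_nat_mult)
  then have "ln (fact (2 * n) :: real) = 2 * ln (fact n) + ln (real (2 * n choose n))"
    by (simp add: ln_mult)
  moreover have "ln (real (2 * n choose n)) \<le> 2 * real n * ln 2"
  proof -
    have "real (2 * n choose n) \<le> 2 ^ (2 * n)"
      using binomial_le_pow2[of "2 * n" n] by (metis of_nat_le_iff of_nat_numeral of_nat_power)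
    then have "ln (real (2 * n choose n)) \<le> ln (2 ^ (2 * n))"
      by (subst ln_le_cancel_iff) auto
    then show ?thesis by (simp add: ln_realpow)
  qed
  moreover have "ln (fact n :: real) = (\<Sum>k=1..2 * n. mangoldt k * real (n div k))"
    unfolding ln_fact_eq_sum_mangoldt by (rule sum.mono_neutral_left) auto
  ultimately have "(\<Sum>k=1..2 * n. mangoldt k * (real (2 * n div k) - 2 * real (n div k))) \<le> 2 * real n * ln 2"
    using ln_fact_eq_sum_mangoldt[of "2 * n"]
    by (simp add: right_diff_distrib sum_subtractf sum_distrib_left mult.left_commute)
  moreover have "(\<Sum>k=1..2 * n. if k \<le> n then 0 else mangoldt k :: real)
      \<le> (\<Sum>k=1..2 * n. mangoldt k * (real (2 * n div k) - 2 * real (n div k)))"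
  proof (rule sum_mono)
    fix k assume k: "k \<in> {1..2 * n}"
    have "2 * (n div k) \<le> 2 * n div k"
      using k by (simp add: less_eq_div_iff_mult_less_eq)
    then have "2 * real (n div k) \<le> real (2 * n div k)"
      by (metis of_nat_le_iff of_nat_mult of_nat_numeral)
    moreover have "1 \<le> 2 * n div k"
      using k by (simp add: less_eq_div_iff_mult_less_eq)
    ultimately show "(if k \<le> n then 0 else mangoldt k) \<le> mangoldt k * (real (2 * n div k) - 2 * real (n div k))"
      using mangoldt_nonneg[of k] mult_left_mono[of 1 "real (2 * n div k)" "mangoldt k"]
      by (auto intro: mult_nonneg_nonneg)
  qed
  moreover have "(\<Sum>k=1..2 * n. mangoldt k :: real)
      = (\<Sum>k=1..n. mangoldt k) + (\<Sum>k=1..2 * n. if k \<le> n then 0 else mangoldt k)"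
  proof -
    have "(\<Sum>k=1..n. mangoldt k :: real) = (\<Sum>k=1..2 * n. if k \<le> n then mangoldt k else 0)"
      by (rule sum.mono_neutral_cong_left) auto
    then show ?thesis
      by (auto simp flip: sum.distrib intro: sum.cong)
  qed
  ultimately show ?thesis by linarith
qed

lemma sum_mangoldt_le: "(\<Sum>k=1..n. mangoldt k :: real) \<le> 3 * real n"
proof (induction n rule: less_induct)
  case (less n)
  have ln2: "ln 2 \<le> (7/10 :: real)"
    using ln2_le_25_over_36 by simp
  \<comment> \<open>Doubling gives at most \<open>3 * m + 1.4 * m\<close>. An odd
    \<open>n = 2 * m - 1\<close> is rounded up to \<open>2 * m\<close>; there
    \<open>m \<ge> 2\<close> ensures both \<open>m < n\<close> and
    \<open>4.4 * m \<le> 3 * (2 * m - 1)\<close>.\<close>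
  consider "n \<le> 1" | m where "n = 2 * m" "m \<ge> 1" | m where "n + 1 = 2 * m" "m \<ge> 2"
  proof (cases "even n")
    case True
    then obtain m where "n = 2 * m" by (rule evenE)
    then show ?thesis using that(1,2) by (cases "m \<ge> 1") auto
  next
    case False
    then obtain m where "n = 2 * m + 1" by (rule oddE)
    then show ?thesis using that(1) that(3)[of "m + 1"] by (cases "m \<ge> 1") auto
  qed
  then show ?case
  proof cases
    case 1
    then show ?thesis by (cases n) (auto simp: le_Suc_eq)
  next
    case (2 m)
    have "real m * ln 2 \<le> real m * (7/10)"
      using ln2 by (intro mult_left_mono) auto
    moreover have "(\<Sum>k=1..m. mangoldt k :: real) \<le> 3 * real m"
      using 2 by (intro less.IH) simp
    moreover have "real n = 2 * real m" using 2 by simp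
    ultimately show ?thesis
      using sum_mangoldt_double_le[of m] unfolding 2(1) by linarith
  next
    case (3 m)
    have "(\<Sum>k=1..n. mangoldt k :: real) \<le> (\<Sum>k=1..2 * m. mangoldt k)"
      using 3 by (intro sum_mono2) (auto intro: mangoldt_nonneg)
    moreover have "real m * ln 2 \<le> real m * (7/10)"
      using ln2 by (intro mult_left_mono) auto
    moreover have "(\<Sum>k=1..m. mangoldt k :: real) \<le> 3 * real m"
      using 3 by (intro less.IH) simp
    moreover have "real n + 1 = 2 * real m"
      using 3(1) by linarith
    moreover have "real m \<ge> 2" using 3 by simp
    ultimately show ?thesis
      using sum_mangoldt_double_le[of m] by linarith
  qed
qed

text \<open>The quotient \<open>n ^ n / fact n\<close> is a single term of the exponential series
  for \<open>exp n\<close>.\<close>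

lemma ln_fact_ge: "real n * ln (real n) - real n \<le> ln (fact n)"
proof (cases "n = 0")
  case False
  have "real n ^ n / fact n \<le> exp (real n)"
  proof -
    have "(\<lambda>k. real n ^ k / fact k) sums exp (real n)"
      using exp_converges[of "real n"] by (simp add: field_simps)
    from sum_le_suminf[OF sums_summable[OF this], of "{n}"] sums_unique[OF this]
    show ?thesis by simp
  qed
  then have "ln (real n ^ n / fact n) \<le> ln (exp (real n))"
    using False by (subst ln_le_cancel_iff) auto
  then show ?thesis
    using False by (simp add: ln_div ln_realpow)
qed simp

text \<open>In the formula for \<open>ln (fact n)\<close>, replacing \<open>n div k\<close> by
  \<open>n / k\<close> adds between 0 and the Chebyshev sum, at most \<open>3 * n\<close>. Since
  \<open>ln (fact n)\<close> lies between \<open>n * ln n - n\<close> and \<open>n * ln n\<close>,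
  dividing by \<open>n\<close> gives the claim.\<close>

theorem mertens_first:
  assumes "n \<ge> 1"
  shows "\<bar>(\<Sum>k=1..n. mangoldt k / real k) - ln (real n)\<bar> \<le> 3"
proof -
  have n: "real n > 0" using assms by simp
  have "(\<Sum>k=1..n. mangoldt k * real (n div k)) \<le> (\<Sum>k=1..n. mangoldt k * (real n / real k))"
    by (intro sum_mono mult_left_mono mangoldt_nonneg) (simp add: of_nat_div_le_of_nat)
  also have "\<dots> = real n * (\<Sum>k=1..n. mangoldt k / real k)"
    by (simp add: sum_distrib_left mult_ac)
  finally have lower: "real n * ln (real n) - real n \<le> real n * (\<Sum>k=1..n. mangoldt k / real k)"
    using ln_fact_ge[of n] ln_fact_eq_sum_mangoldt[of n] by linarith
  have "real n * (\<Sum>k=1..n. mangoldt k / real k) = (\<Sum>k=1..n. mangoldt k * (real n / real k))"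
    by (simp add: sum_distrib_left mult_ac)
  also have "\<dots> \<le> (\<Sum>k=1..n. mangoldt k * (real (n div k) + 1))"
  proof (intro sum_mono mult_left_mono mangoldt_nonneg)
    fix k assume "k \<in> {1..n}"
    then have "n < (n div k + 1) * k"
      using dividend_less_div_times[of k n] by (simp add: algebra_simps)
    then have "real n < (real (n div k) + 1) * real k"
      by (metis of_nat_1 of_nat_add of_nat_less_iff of_nat_mult)
    then show "real n / real k \<le> real (n div k) + 1"
      using \<open>k \<in> {1..n}\<close> by (simp add: divide_le_eq)
  qed
  also have "\<dots> = ln (fact n) + (\<Sum>k=1..n. mangoldt k)"
    by (simp add: ln_fact_eq_sum_mangoldt distrib_left sum.distrib)
  also have "ln (fact n :: real) \<le> real n * ln (real n)"
  proof -
    have "(fact n :: real) \<le> real n ^ n"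
      using fact_le_power[of n, where ?'a = real] by simp
    then have "ln (fact n :: real) \<le> ln (real n ^ n)"
      using n by (subst ln_le_cancel_iff) auto
    then show ?thesis using n by (simp add: ln_realpow)
  qed
  finally have upper: "real n * (\<Sum>k=1..n. mangoldt k / real k) \<le> real n * ln (real n) + 3 * real n"
    using sum_mangoldt_le[of n] by linarith
  from lower have "real n * (ln (real n) - 1) \<le> real n * (\<Sum>k=1..n. mangoldt k / real k)"
    by (simp add: algebra_simps)
  moreover from upper have "real n * (\<Sum>k=1..n. mangoldt k / real k) \<le> real n * (ln (real n) + 3)"
    by (simp add: algebra_simps)
  ultimately have "ln (real n) - 1 \<le> (\<Sum>k=1..n. mangoldt k / real k)"
    "(\<Sum>k=1..n. mangoldt k / real k) \<le> ln (real n) + 3"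
    using n by (simp_all only: mult_le_cancel_left_pos)
  then show ?thesis by linarith
qed

section \<open>Partial summation against Mertens' estimate\<close>

text \<open>\<open>P\<close> majorizes the variation of \<open>q\<close>, so that oscillating \<open>q\<close> are allowed.\<close>

lemma sum_mangoldt_div_le_integral:
  fixes q P Q :: "real \<Rightarrow> real"
  assumes K: "1 \<le> K" "K \<le> N"
    and Q: "\<And>v. ln (real K) \<le> v \<Longrightarrow> (Q has_real_derivative q v) (at v)"
    and P: "\<And>a b. ln (real K) \<le> a \<Longrightarrow> a \<le> b \<Longrightarrow> \<bar>q a - q b\<bar> \<le> P b - P a"
    and q: "\<And>v. ln (real K) \<le> v \<Longrightarrow> 0 \<le> q v"
  shows "(\<Sum>k\<in>{K<..N}. mangoldt k / real k * q (ln (real k)))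
    \<le> Q (ln (real N)) - Q (ln (real K)) + 4 * (P (ln (real N)) - P (ln (real K)))
      + 3 * (q (ln (real N)) + q (ln (real K)))"
proof -
  define E where "E n = (\<Sum>k=1..n. mangoldt k / real k) - ln (real n)" for n
  have E: "\<bar>E n\<bar> \<le> 3" if "n \<ge> 1" for n
    using mertens_first[OF that] by (simp add: E_def)
  \<comment> \<open>Abel summation as an induction on \<open>N\<close>; keeping the boundary values
    of \<open>E\<close> exact lets them telescope. Each step costs one variation of \<open>P\<close>
    for replacing the mean value \<open>q z\<close> by the endpoint value \<open>q b\<close>, and
    three for the Mertens error, hence the factor 4.\<close>
  have "(\<Sum>k\<in>{K<..N}. mangoldt k / real k * q (ln (real k)))
    \<le> Q (ln (real N)) - Q (ln (real K)) + 4 * (P (ln (real N)) - P (ln (real K)))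
      + E N * q (ln (real N)) - E K * q (ln (real K))"
    using K(2)
  proof (induction N rule: dec_induct)
    case (step n)
    define a b where "a = ln (real n)" and "b = ln (real (Suc n))"
    have a: "ln (real K) \<le> a" using step K by (simp add: a_def)
    have ab: "a < b" using step K by (simp add: a_def b_def)
    have "b - a \<le> 1"
    proof -
      have "b - a = ln (1 + 1 / real n)"
        using step K by (simp add: a_def b_def add_divide_distrib add.commute flip: ln_divide_pos)
      also have "\<dots> \<le> 1 / real n" by (rule ln_add_one_self_le_self) simp
      also have "\<dots> \<le> 1" using step K by simp
      finally show ?thesis .
    qed
    have "\<exists>z>a. z < b \<and> Q b - Q a = (b - a) * q z"
      using a ab by (intro MVT2) (auto intro: Q)
    then obtain z where z: "a < z" "z < b" "Q b - Q a = (b - a) * q z" by blast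
    have PP: "\<bar>q a - q b\<bar> \<le> P b - P a" "\<bar>q z - q b\<bar> \<le> P b - P z" "\<bar>q a - q z\<bar> \<le> P z - P a"
      using P a z ab by auto
    have "(b - a) * q b \<le> (b - a) * (q z + (P b - P a))"
      using PP ab by (intro mult_left_mono) linarith+
    also have "\<dots> = Q b - Q a + (b - a) * (P b - P a)"
      using z by (simp add: algebra_simps)
    also have "(b - a) * (P b - P a) \<le> 1 * (P b - P a)"
      using PP \<open>b - a \<le> 1\<close> by (intro mult_right_mono) linarith+
    finally have 1: "(b - a) * q b \<le> Q b - Q a + (P b - P a)" by simp
    have "\<bar>E n * (q a - q b)\<bar> \<le> 3 * (P b - P a)"
      unfolding abs_mult using E[of n] PP(1) step K by (intro mult_mono) auto
    then have 2: "E n * q a - E n * q b \<le> 3 * (P b - P a)"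
      by (simp add: algebra_simps)
    have "mangoldt (Suc n) / real (Suc n) = E (Suc n) - E n + (b - a)"
      by (simp add: E_def a_def b_def)
    then have "mangoldt (Suc n) / real (Suc n) * q b = (E (Suc n) - E n + (b - a)) * q b"
      by (simp only:)
    also have "\<dots> = E (Suc n) * q b - E n * q b + (b - a) * q b"
      by (simp add: algebra_simps)
    finally have "mangoldt (Suc n) / real (Suc n) * q b = E (Suc n) * q b - E n * q b + (b - a) * q b" .
    moreover have "{K<..Suc n} = insert (Suc n) {K<..n}"
      using step by auto
    ultimately show ?case
      using step.IH 1 2 by (simp add: a_def b_def del: of_nat_Suc)
  qed simp
  moreover have "E N * q (ln (real N)) \<le> 3 * q (ln (real N))"
    using E[of N] K q[of "ln (real N)"] by (intro mult_right_mono) auto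
  moreover have "- E K * q (ln (real K)) \<le> 3 * q (ln (real K))"
    using E[of K] K q[of "ln (real K)"] by (intro mult_right_mono) auto
  ultimately show ?thesis by simp
qed

section \<open>The sinc kernel\<close>

lemma phi_has_real_derivative: "(phi has_real_derivative (sinc (pi * x))\<^sup>2) (at x)"
proof -
  \<comment> \<open>The integrals run over open intervals with endpoint 0, so the integrands never
    differ there; \<open>sinc\<close> is continuous at 0, as the fundamental theorem
    requires.\<close>
  have eq: "phi = (\<lambda>x. LBINT u=ereal 0..ereal x. (sinc (pi * u))\<^sup>2)"
    unfolding phi_def by (intro ext interval_integral_cong) (auto simp: einterval_def min_def max_def split: if_splits)
  have "(at x within {min 0 (x - 1)..max 0 (x + 1)}) = at x"
    by (intro at_within_interior) auto
  moreover have "continuous_on {min 0 (x - 1)..max 0 (x + 1)} (\<lambda>u. (sinc (pi * u))\<^sup>2)"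
    by (intro continuous_intros)
  ultimately show ?thesis
    using interval_integral_FTC2[of "min 0 (x - 1)" 0 "max 0 (x + 1)" "\<lambda>u. (sinc (pi * u))\<^sup>2" x]
    by (simp add: eq has_real_derivative_iff_has_vector_derivative)
qed

lemma phi_mono: "x \<le> y \<Longrightarrow> phi x \<le> phi y"
  by (rule DERIV_nonneg_imp_nondecreasing) (auto intro!: phi_has_real_derivative exI)

lemma phi_0 [simp]: "phi 0 = 0"
  by (simp add: phi_def)

lemma phi_nonneg: "0 \<le> x \<Longrightarrow> 0 \<le> phi x"
  using phi_mono[of 0 x] by simp

lemma half_le_sin:
  assumes "0 \<le> x" "x \<le> 1/2"
  shows "x / 2 \<le> sin (x::real)"
proof -
  have "sin 0 - 0 / 2 \<le> sin x - x / 2"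
  proof (rule DERIV_nonneg_imp_nondecreasing[OF assms(1)])
    fix u :: real assume u: "0 \<le> u" "u \<le> x"
    have "cos (pi / 3) \<le> cos u"
      using u assms pi_ge_two by (intro cos_monotone_0_pi_le) auto
    then show "\<exists>y. ((\<lambda>x. sin x - x / 2) has_real_derivative y) (at u) \<and> 0 \<le> y"
      by (intro exI[of _ "cos u - 1/2"]) (auto intro!: derivative_eq_intros simp: cos_60)
  qed
  then show ?thesis by simp
qed

text \<open>On this range \<open>sinc (pi * u)\<close> is at least 1/2, so \<open>phi\<close> has
  derivative at least 1/4. This lower bound later pays for the Mertens error.\<close>

lemma phi_ge_linear:
  assumes "0 \<le> x" "pi * x \<le> 1/2"
  shows "x / 4 \<le> phi x"
proof -
  have "phi 0 - 0 / 4 \<le> phi x - x / 4"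
  proof (rule DERIV_nonneg_imp_nondecreasing[OF assms(1)])
    fix u :: real assume u: "0 \<le> u" "u \<le> x"
    have "pi * u \<le> pi * x" using u by simp
    then have "pi * u / 2 \<le> sin (pi * u)"
      using u assms(2) by (intro half_le_sin) (simp, linarith)
    then have "1/2 \<le> sinc (pi * u)"
      using u by (auto simp: divide_simps)
    then have "(1/2)\<^sup>2 \<le> (sinc (pi * u))\<^sup>2"
      by (intro power_mono) auto
    then show "\<exists>y. ((\<lambda>x. phi x - x / 4) has_real_derivative y) (at u) \<and> 0 \<le> y"
      by (intro exI[of _ "(sinc (pi * u))\<^sup>2 - 1/4"])
         (auto intro!: derivative_eq_intros phi_has_real_derivative simp: power2_eq_square)
  qed
  then show ?thesis by simp
qed

text \<open>The left side is the numerator in the derivative of \<open>sin u / u\<close>. Its own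
  derivative, \<open>- u * sin u\<close>, is dominated by \<open>2 * u\<close>.\<close>

lemma abs_sin_minus_cos_le:
  assumes "0 \<le> (u::real)"
  shows "\<bar>u * cos u - sin u\<bar> \<le> u\<^sup>2"
proof -
  have s: "\<bar>t * sin t\<bar> \<le> 2 * t" if "0 \<le> t" for t :: real
    using that mult_left_mono[OF order_trans[OF abs_sin_le_one[of t]], of 2 t]
    by (simp add: abs_mult mult.commute)
  have "0\<^sup>2 - (0 * cos 0 - sin 0) \<le> u\<^sup>2 - (u * cos u - sin u)"
  proof (rule DERIV_nonneg_imp_nondecreasing[OF assms])
    fix t :: real assume "0 \<le> t" "t \<le> u"
    then show "\<exists>y. ((\<lambda>u. u\<^sup>2 - (u * cos u - sin u)) has_real_derivative y) (at t) \<and> 0 \<le> y"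
      using s[of t] by (intro exI[of _ "2 * t + t * sin t"]) (auto intro!: derivative_eq_intros)
  qed
  moreover have "0\<^sup>2 + (0 * cos 0 - sin 0) \<le> u\<^sup>2 + (u * cos u - sin u)"
  proof (rule DERIV_nonneg_imp_nondecreasing[OF assms])
    fix t :: real assume "0 \<le> t" "t \<le> u"
    then show "\<exists>y. ((\<lambda>u. u\<^sup>2 + (u * cos u - sin u)) has_real_derivative y) (at t) \<and> 0 \<le> y"
      using s[of t] by (intro exI[of _ "2 * t - t * sin t"]) (auto intro!: derivative_eq_intros)
  qed
  ultimately show ?thesis by simp
qed

text \<open>The derivative of the squared kernel is at most \<open>8 / (1 + u^2)\<close> in absolute
  value, the derivative of \<open>8 * arctan u\<close>. As \<open>arctan\<close> is bounded, the
  total variation stays bounded however long the range.\<close>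

lemma sinc_squared_variation:
  assumes "0 < a" "a \<le> (b::real)"
  shows "\<bar>(sin a / a)\<^sup>2 - (sin b / b)\<^sup>2\<bar> \<le> 8 * arctan b - 8 * arctan a"
proof -
  define D where "D u = 2 * (sin u / u) * ((u * cos u - sin u) / u\<^sup>2)" for u :: real
  have D: "((\<lambda>u. (sin u / u)\<^sup>2) has_real_derivative D u) (at u)" if "0 < u" for u
    unfolding D_def using that
    by (auto intro!: derivative_eq_intros simp: power2_eq_square field_simps)
  \<comment> \<open>Up to 1 the derivative is at most 2 while the majorant is at least 4; beyond 1
    it is at most \<open>4 / u^2\<close>, and \<open>1 + u^2 \<le> 2 * u^2\<close>.\<close>
  have bound: "\<bar>D u\<bar> \<le> 8 / (1 + u\<^sup>2)" if u: "0 < u" for u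
  proof (cases "u \<le> 1")
    case True
    have "\<bar>sin u / u\<bar> \<le> 1"
      using abs_sin_x_le_abs_x[of u] u by simp
    moreover have "\<bar>(u * cos u - sin u) / u\<^sup>2\<bar> \<le> 1"
      using abs_sin_minus_cos_le[of u] u by simp
    ultimately have "\<bar>D u\<bar> \<le> 2 * 1 * 1"
      unfolding D_def abs_mult by (intro mult_mono) auto
    moreover have "u\<^sup>2 \<le> 1" using True u by (simp add: power_le_one)
    then have "2 \<le> 8 / (1 + u\<^sup>2)"
      using u by (subst le_divide_eq) (auto simp: add_pos_nonneg)
    ultimately show ?thesis by linarith
  next
    case False
    have "\<bar>u * cos u - sin u\<bar> \<le> \<bar>u * cos u\<bar> + \<bar>sin u\<bar>" by linarith
    also have "\<bar>u * cos u\<bar> \<le> u * 1"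
      unfolding abs_mult using u by (intro mult_mono) auto
    also have "\<bar>sin u\<bar> \<le> u" using False abs_sin_le_one[of u] by linarith
    finally have "\<bar>u * cos u - sin u\<bar> \<le> 2 * u" by simp
    then have "\<bar>(u * cos u - sin u) / u\<^sup>2\<bar> \<le> 2 / u"
      using u by (simp add: divide_le_eq power2_eq_square)
    moreover have "\<bar>sin u / u\<bar> \<le> 1 / u"
      using u by (simp add: divide_right_mono)
    ultimately have "\<bar>D u\<bar> \<le> 2 * (1 / u) * (2 / u)"
      unfolding D_def abs_mult using u by (intro mult_mono) auto
    also have "\<dots> = 4 / u\<^sup>2" by (simp add: power2_eq_square)
    also have "\<dots> \<le> 8 / (1 + u\<^sup>2)"
      using False u power_mono[of 1 u 2] by (simp add: divide_simps add_pos_nonneg)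
    finally show ?thesis .
  qed
  have "8 * arctan a - (sin a / a)\<^sup>2 \<le> 8 * arctan b - (sin b / b)\<^sup>2"
  proof (rule DERIV_nonneg_imp_nondecreasing[OF assms(2)])
    fix u assume "a \<le> u" "u \<le> b"
    then have "0 < u" using assms by linarith
    then show "\<exists>y. ((\<lambda>u. 8 * arctan u - (sin u / u)\<^sup>2) has_real_derivative y) (at u) \<and> 0 \<le> y"
      using bound[of u] D[of u]
      by (intro exI[of _ "8 / (1 + u\<^sup>2) - D u"])
         (auto intro!: DERIV_diff derivative_eq_intros simp: divide_inverse)
  qed
  moreover have "8 * arctan a + (sin a / a)\<^sup>2 \<le> 8 * arctan b + (sin b / b)\<^sup>2"
  proof (rule DERIV_nonneg_imp_nondecreasing[OF assms(2)])
    fix u assume "a \<le> u" "u \<le> b"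
    then have "0 < u" using assms by linarith
    then show "\<exists>y. ((\<lambda>u. 8 * arctan u + (sin u / u)\<^sup>2) has_real_derivative y) (at u) \<and> 0 \<le> y"
      using bound[of u] D[of u]
      by (intro exI[of _ "8 / (1 + u\<^sup>2) + D u"])
         (auto intro!: DERIV_add derivative_eq_intros simp: divide_inverse)
  qed
  ultimately show ?thesis by linarith
qed

section \<open>Von Mangoldt sums over \<open>k > K\<close> against the kernel\<close>

text \<open>The summand function is \<open>(h / 2)^2\<close> times the squared kernel at
  \<open>h / 2 * v\<close>, so both its size and its variation are of order \<open>h^2\<close>,
  uniformly in \<open>N\<close>.\<close>

lemma sum_mangoldt_sin_small:
  assumes h: "0 < h" and K: "1 < K" "K \<le> N"
  shows "(\<Sum>k\<in>{K<..N}. mangoldt k / real k * (sin (h / 2 * ln (real k)) / ln (real k))\<^sup>2)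
    \<le> pi * h / 2 * phi (h / (2 * pi) * ln (real N))
      - pi * h / 2 * phi (h / (2 * pi) * ln (real K)) + 18 * h\<^sup>2"
proof -
  define q where "q v = (sin (h / 2 * v) / v)\<^sup>2" for v
  \<comment> \<open>The scaling makes \<open>Q\<close> an antiderivative of \<open>q\<close>,
    because \<open>pi * h / 2 * (h / (2 * pi)) = (h / 2)^2\<close>.\<close>
  define Q where "Q v = pi * h / 2 * phi (h / (2 * pi) * v)" for v
  define P where "P v = (h / 2)\<^sup>2 * (8 * arctan (h / 2 * v))" for v
  have lnK: "0 < ln (real K)" using K by simp
  have q_eq: "q v = (h / 2)\<^sup>2 * (sin (h / 2 * v) / (h / 2 * v))\<^sup>2" if "0 < v" for v
    using h that by (simp add: q_def power_divide power_mult_distrib)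
  have q_le: "q v \<le> h\<^sup>2 / 4" if "0 < v" for v
  proof -
    have "\<bar>sin (h / 2 * v) / (h / 2 * v)\<bar> \<le> 1"
      using abs_sin_x_le_abs_x[of "h / 2 * v"] h that by (simp add: divide_le_eq)
    then have "(sin (h / 2 * v) / (h / 2 * v))\<^sup>2 \<le> 1"
      by (simp add: abs_square_le_1)
    then have "q v \<le> (h / 2)\<^sup>2 * 1"
      unfolding q_eq[OF that] by (intro mult_left_mono) auto
    then show ?thesis by (simp add: power_divide)
  qed
  have "(\<Sum>k\<in>{K<..N}. mangoldt k / real k * q (ln (real k)))
    \<le> Q (ln (real N)) - Q (ln (real K)) + 4 * (P (ln (real N)) - P (ln (real K)))
      + 3 * (q (ln (real N)) + q (ln (real K)))"
  proof (rule sum_mangoldt_div_le_integral)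
    fix v assume "ln (real K) \<le> v"
    then have v: "0 < v" using lnK by linarith
    have "(Q has_real_derivative pi * h / 2 * ((sinc (pi * (h / (2 * pi) * v)))\<^sup>2 * (h / (2 * pi)))) (at v)"
      unfolding Q_def
      by (intro DERIV_cmult DERIV_chain2[OF phi_has_real_derivative])
         (auto intro!: derivative_eq_intros)
    also have "pi * h / 2 * ((sinc (pi * (h / (2 * pi) * v)))\<^sup>2 * (h / (2 * pi))) = q v"
      using h v by (simp add: q_eq power2_eq_square)
    finally show "(Q has_real_derivative q v) (at v)" .
  next
    fix a b assume ab: "ln (real K) \<le> a" "a \<le> b"
    then have "\<bar>(sin (h / 2 * a) / (h / 2 * a))\<^sup>2 - (sin (h / 2 * b) / (h / 2 * b))\<^sup>2\<bar>
        \<le> 8 * arctan (h / 2 * b) - 8 * arctan (h / 2 * a)"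
      using h lnK by (intro sinc_squared_variation) auto
    then have "(h / 2)\<^sup>2 * \<bar>(sin (h / 2 * a) / (h / 2 * a))\<^sup>2 - (sin (h / 2 * b) / (h / 2 * b))\<^sup>2\<bar>
        \<le> (h / 2)\<^sup>2 * (8 * arctan (h / 2 * b) - 8 * arctan (h / 2 * a))"
      by (intro mult_left_mono) auto
    moreover have "q a - q b = (h / 2)\<^sup>2 * ((sin (h / 2 * a) / (h / 2 * a))\<^sup>2 - (sin (h / 2 * b) / (h / 2 * b))\<^sup>2)"
      using ab lnK by (simp add: q_eq right_diff_distrib)
    ultimately have "\<bar>q a - q b\<bar> \<le> (h / 2)\<^sup>2 * (8 * arctan (h / 2 * b) - 8 * arctan (h / 2 * a))"
      by (simp only: abs_mult abs_power2)
    then show "\<bar>q a - q b\<bar> \<le> P b - P a"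
      by (simp only: P_def right_diff_distrib)
  qed (use K in \<open>auto simp: q_def\<close>)
  moreover have "P (ln (real N)) - P (ln (real K)) \<le> 4 * h\<^sup>2"
  proof -
    have "arctan (h / 2 * ln (real N)) - arctan (h / 2 * ln (real K)) \<le> 2"
    proof -
      have "0 \<le> arctan (h / 2 * ln (real K))"
        using h lnK by simp
      then show ?thesis
        using arctan_ubound[of "h / 2 * ln (real N)"] pi_less_4 by linarith
    qed
    then have "(h / 2)\<^sup>2 * 8 * (arctan (h / 2 * ln (real N)) - arctan (h / 2 * ln (real K))) \<le> (h / 2)\<^sup>2 * 8 * 2"
      by (intro mult_left_mono) auto
    then show ?thesis by (simp add: P_def power_divide algebra_simps)
  qed
  moreover have "q (ln (real N)) \<le> h\<^sup>2 / 4" "q (ln (real K)) \<le> h\<^sup>2 / 4"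
    using q_le K lnK by auto
  moreover have "0 \<le> h\<^sup>2" by simp
  \<comment> \<open>The variation contributes \<open>4 * 4 * h^2\<close> and the two boundary values
    \<open>3 * (1/4 + 1/4) * h^2\<close>, together 17.5 times \<open>h^2\<close>.\<close>
  ultimately have "(\<Sum>k\<in>{K<..N}. mangoldt k / real k * q (ln (real k)))
      \<le> Q (ln (real N)) - Q (ln (real K)) + 18 * h\<^sup>2"
    by argo
  then show ?thesis by (simp only: q_def Q_def)
qed

text \<open>Serves the \<open>h\<close> that are not small, where the sine is bounded by 1. As
  \<open>1 / v^2\<close> decreases, its negative measures its variation; the 10 is 4 + 3 +
  3.\<close>

lemma sum_mangoldt_div_ln_squared_le:
  assumes K: "1 < K" "K \<le> N"
  shows "(\<Sum>k\<in>{K<..N}. mangoldt k / real k * (1 / (ln (real k))\<^sup>2))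
    \<le> 1 / ln (real K) + 10 / (ln (real K))\<^sup>2"
proof -
  have lnK: "0 < ln (real K)" and lnN: "ln (real K) \<le> ln (real N)" using K by auto
  have anti: "1 / b\<^sup>2 \<le> 1 / a\<^sup>2" if "0 < a" "a \<le> b" for a b :: real
    using that by (intro divide_left_mono power_mono) auto
  have "(\<Sum>k\<in>{K<..N}. mangoldt k / real k * (1 / (ln (real k))\<^sup>2))
    \<le> - (1 / ln (real N)) - - (1 / ln (real K)) + 4 * (- (1 / (ln (real N))\<^sup>2) - - (1 / (ln (real K))\<^sup>2))
      + 3 * (1 / (ln (real N))\<^sup>2 + 1 / (ln (real K))\<^sup>2)"
  proof (rule sum_mangoldt_div_le_integral)
    fix v assume "ln (real K) \<le> v"
    then have v: "0 < v" using lnK by linarith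
    then show "((\<lambda>v. - (1 / v)) has_real_derivative 1 / v\<^sup>2) (at v)"
      by (auto intro!: derivative_eq_intros simp: power2_eq_square)
  next
    fix a b assume "ln (real K) \<le> a" "a \<le> b"
    then show "\<bar>1 / a\<^sup>2 - 1 / b\<^sup>2\<bar> \<le> - (1 / b\<^sup>2) - - (1 / a\<^sup>2)"
      using anti[of a b] lnK by simp
  qed (use K in auto)
  moreover have "0 \<le> 1 / ln (real N)" using lnK lnN by simp
  moreover have "1 / (ln (real N))\<^sup>2 \<le> 1 / (ln (real K))\<^sup>2"
    using anti[OF lnK lnN] .
  moreover have "0 \<le> 1 / (ln (real N))\<^sup>2" "0 \<le> 1 / (ln (real K))\<^sup>2" by simp_all
  moreover have "10 / (ln (real K))\<^sup>2 = 10 * (1 / (ln (real K))\<^sup>2)" by simp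
  ultimately show ?thesis by argo
qed

text \<open>The cutoff \<open>K\<close> is absolute. Leaving out the \<open>k \<le> K\<close> makes the sum exceed
  \<open>Q(ln X) - Q(ln K)\<close>, where \<open>Q v = pi * h / 2 * phi (h / (2 * pi) * v)\<close>, by at most the Mertens
  error, and \<open>Q(ln K)\<close> absorbs it: for small \<open>h\<close> the error is \<open>O(h\<^sup>2)\<close> while \<open>Q(ln K)\<close> is at
  least a large multiple of \<open>h\<^sup>2\<close>; for the other \<open>h\<close> the whole tail is \<open>O(1 / ln K)\<close> while
  \<open>Q(ln K)\<close> is bounded below.\<close>

theorem mangoldt_tail_le_phi:
  obtains K where "K > 1"
    "\<And>h X. 0 < h \<Longrightarrow> 1 \<le> X \<Longrightarrow>
      (\<Sum>k | K < k \<and> real k \<le> X. mangoldt k / real k * (sin (h / 2 * ln (real k)) / ln (real k))\<^sup>2)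
      \<le> pi * h / 2 * phi (h / (2 * pi) * ln X)"
proof -
  \<comment> \<open>\<open>ln K\<close> must exceed 288, the largest \<open>t\<close> put into
    \<open>gain\<close> below, and make \<open>1 / ln K + 10 / (ln K)^2\<close> at most
    1/4608.\<close>
  obtain K :: nat where K: "exp 10000 < real K"
    using reals_Archimedean2 by blast
  then have "ln (exp 10000) \<le> ln (real K)"
    by (intro ln_mono) auto
  then have lnK: "10000 \<le> ln (real K)" by simp
  have K1: "K > 1"
  proof (rule ccontr)
    assume "\<not> K > 1"
    then have "ln (real K) \<le> 0" by (auto simp: not_less le_Suc_eq)
    then show False using lnK by simp
  qed
  have main: "(\<Sum>k | K < k \<and> real k \<le> X. mangoldt k / real k * (sin (h / 2 * ln (real k)) / ln (real k))\<^sup>2)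
      \<le> pi * h / 2 * phi (h / (2 * pi) * ln X)" if h: "0 < h" and X: "1 \<le> X" for h X
  proof -
    define N where "N = nat \<lfloor>X\<rfloor>"
    have set_eq: "{k. K < k \<and> real k \<le> X} = {K<..N}"
      using X by (auto simp: N_def le_nat_floor nat_le_iff le_floor_iff) (simp add: le_nat_iff le_floor_iff)+
    have N: "1 \<le> N" "real N \<le> X"
      using X by (auto simp: N_def le_nat_iff le_floor_iff)
    show ?thesis
    proof (cases "K \<le> N")
      case False
      then show ?thesis unfolding set_eq using h X by (auto intro!: mult_nonneg_nonneg phi_nonneg)
    next
      case True
      have "phi (h / (2 * pi) * ln (real N)) \<le> phi (h / (2 * pi) * ln X)"
        using N h by (intro phi_mono mult_left_mono) auto
      then have N_le: "pi * h / 2 * phi (h / (2 * pi) * ln (real N)) \<le> pi * h / 2 * phi (h / (2 * pi) * ln X)"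
        using h by (intro mult_left_mono) auto
      \<comment> \<open>The condition \<open>h * t \<le> 1\<close> keeps the argument in the range
        where \<open>phi\<close> is bounded below linearly; monotonicity then carries the bound from
        \<open>t\<close> to \<open>ln K\<close>.\<close>
      have gain: "h\<^sup>2 * t / 16 \<le> pi * h / 2 * phi (h / (2 * pi) * ln (real K))"
        if t: "0 \<le> t" "t \<le> ln (real K)" "h * t \<le> 1" for t
      proof -
        have "h / (2 * pi) * t / 4 \<le> phi (h / (2 * pi) * t)"
          using h t by (intro phi_ge_linear) auto
        also have "\<dots> \<le> phi (h / (2 * pi) * ln (real K))"
          using h t by (intro phi_mono mult_left_mono) auto
        finally have "pi * h / 2 * (h / (2 * pi) * t / 4) \<le> pi * h / 2 * phi (h / (2 * pi) * ln (real K))"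
          using h by (intro mult_left_mono) auto
        then show ?thesis by (simp add: power2_eq_square)
      qed
      show ?thesis
      \<comment> \<open>Since 288 / 16 = 18, taking \<open>t = 288\<close> absorbs the error
        \<open>18 * h^2\<close>; this needs \<open>288 * h \<le> 1\<close>.\<close>
      proof (cases "h \<le> 1/288")
        case True
        then have "18 * h\<^sup>2 \<le> pi * h / 2 * phi (h / (2 * pi) * ln (real K))"
          using gain[of 288] lnK by simp
        then show ?thesis
          unfolding set_eq using sum_mangoldt_sin_small[OF h K1 \<open>K \<le> N\<close>] N_le by linarith
      next
        case False
        \<comment> \<open>Now \<open>t = 1 / h\<close> is the largest admissible choice, and
          \<open>h / 16\<close> exceeds 1 / (288 * 16) = 1/4608.\<close>
        have "1 / h \<le> 288" using False h by (simp add: divide_le_eq)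
        then have "h / 16 \<le> pi * h / 2 * phi (h / (2 * pi) * ln (real K))"
          using gain[of "1 / h"] h lnK by (simp add: power2_eq_square)
        also have "\<dots> \<le> pi * h / 2 * phi (h / (2 * pi) * ln (real N))"
          using h K1 \<open>K \<le> N\<close> by (intro mult_left_mono phi_mono) auto
        finally have lower: "1 / 4608 \<le> pi * h / 2 * phi (h / (2 * pi) * ln (real N))"
          using False by linarith
        have "(\<Sum>k\<in>{K<..N}. mangoldt k / real k * (sin (h / 2 * ln (real k)) / ln (real k))\<^sup>2)
            \<le> (\<Sum>k\<in>{K<..N}. mangoldt k / real k * (1 / (ln (real k))\<^sup>2))"
          by (intro sum_mono mult_left_mono)
             (auto simp: power_divide mangoldt_nonneg abs_square_le_1 intro!: divide_right_mono)
        also have "\<dots> \<le> 1 / ln (real K) + 10 / (ln (real K))\<^sup>2"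
          using K1 \<open>K \<le> N\<close> by (rule sum_mangoldt_div_ln_squared_le)
        also have "1 / ln (real K) \<le> 1 / 10000"
          using lnK by (intro divide_left_mono) auto
        also have "10 / (ln (real K))\<^sup>2 \<le> 10 / 10000\<^sup>2"
          using lnK by (intro divide_left_mono power_mono) auto
        also have "1 / 10000 + 10 / 10000\<^sup>2 \<le> (1 / 4608 :: real)"
          by (simp add: power2_eq_square)
        finally show ?thesis
          unfolding set_eq using lower N_le by linarith
      qed
    qed
  qed
  show thesis using that[OF K1 main] .
qed

section \<open>The bilinear form\<close>

lemma finite_nat_le_real: "finite {n::nat. P n \<and> real n \<le> L}"
proof (rule finite_subset)
  show "{n. P n \<and> real n \<le> L} \<subseteq> {..nat \<lfloor>L\<rfloor>}"
    by (auto simp: le_nat_floor)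
qed simp

lemma finite_pairs:
  "finite {(k, m). 2 \<le> k \<and> 1 \<le> m \<and> real (k * m) \<le> L}"
proof (rule finite_subset)
  show "{(k, m). 2 \<le> k \<and> 1 \<le> m \<and> real (k * m) \<le> L}
      \<subseteq> {k. True \<and> real k \<le> L} \<times> {m. True \<and> real m \<le> L}"
  proof clarify
    fix k m :: nat assume km: "2 \<le> k" "1 \<le> m" "real (k * m) \<le> L"
    then have "k \<le> k * m" "m \<le> k * m" by auto
    then have "real k \<le> real (k * m)" "real m \<le> real (k * m)" by (simp_all only: of_nat_le_iff)
    with km(3) show "k \<in> {k. True \<and> real k \<le> L} \<and> m \<in> {m. True \<and> real m \<le> L}"
      by simp
  qed
qed (intro finite_cartesian_product finite_nat_le_real)

text \<open>Groups the terms that will carry \<open>|f(m)|^2\<close>. The bound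
  \<open>m \<le> L\<close> follows from \<open>m \<le> k * m\<close>.\<close>

lemma sum_pairs_by_cofactor:
  fixes F :: "nat \<Rightarrow> nat \<Rightarrow> real"
  shows "(\<Sum>(k, m) | 2 \<le> k \<and> 1 \<le> m \<and> real (k * m) \<le> L. F k m)
    = (\<Sum>m | 1 \<le> m \<and> real m \<le> L. \<Sum>k | 2 \<le> k \<and> real k \<le> L / real m. F k m)"
proof -
  have "(\<Sum>m | 1 \<le> m \<and> real m \<le> L. \<Sum>k | 2 \<le> k \<and> real k \<le> L / real m. F k m)
    = (\<Sum>(m, k)\<in>Sigma {m. 1 \<le> m \<and> real m \<le> L} (\<lambda>m. {k. 2 \<le> k \<and> real k \<le> L / real m}). F k m)"
    by (rule sum.Sigma) (auto intro: finite_nat_le_real)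
  also have "\<dots> = (\<Sum>(k, m) | 2 \<le> k \<and> 1 \<le> m \<and> real (k * m) \<le> L. F k m)"
  proof (rule sum.reindex_bij_witness[where i = prod.swap and j = prod.swap])
    fix p assume "p \<in> {(k, m). 2 \<le> k \<and> 1 \<le> m \<and> real (k * m) \<le> L}"
    then obtain k m where p: "p = (k, m)" "2 \<le> k" "1 \<le> m" "real (k * m) \<le> L" by blast
    have "real m \<le> real (k * m)"
      unfolding of_nat_le_iff using p by simp
    then have "real m \<le> L"
      using p(4) by (rule order_trans)
    then show "prod.swap p \<in> Sigma {m. 1 \<le> m \<and> real m \<le> L} (\<lambda>m. {k. 2 \<le> k \<and> real k \<le> L / real m})"
      using p by (simp add: le_divide_eq)
  qed (auto simp: le_divide_eq)
  finally show ?thesis ..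
qed

text \<open>Groups the terms that will carry \<open>|f(k * m)|^2\<close>: for fixed
  \<open>l = k * m\<close> the pairs correspond to the divisors \<open>k\<close> of
  \<open>l\<close>, with \<open>m = l div k\<close>.\<close>

lemma sum_pairs_by_product:
  fixes F :: "nat \<Rightarrow> nat \<Rightarrow> real"
  shows "(\<Sum>(k, m) | 2 \<le> k \<and> 1 \<le> m \<and> real (k * m) \<le> L. F k (k * m))
    = (\<Sum>l | 1 \<le> l \<and> real l \<le> L. \<Sum>k | 2 \<le> k \<and> k dvd l. F k l)"
proof -
  have "(\<Sum>l | 1 \<le> l \<and> real l \<le> L. \<Sum>k | 2 \<le> k \<and> k dvd l. F k l)
    = (\<Sum>(l, k)\<in>Sigma {l. 1 \<le> l \<and> real l \<le> L} (\<lambda>l. {k. 2 \<le> k \<and> k dvd l}). F k l)"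
    by (rule sum.Sigma) (auto intro: finite_nat_le_real)
  also have "\<dots> = (\<Sum>(k, m) | 2 \<le> k \<and> 1 \<le> m \<and> real (k * m) \<le> L. F k (k * m))"
    by (rule sum.reindex_bij_witness[where i = "\<lambda>(k, m). (k * m, k)" and j = "\<lambda>(l, k). (k, l div k)"])
       (auto simp: Suc_le_eq elim!: dvdE)
  finally show ?thesis ..
qed

lemma weighted_am_gm:
  fixes t y d :: real
  assumes "0 < d"
  shows "t * y \<le> (d * t\<^sup>2 + y\<^sup>2 / d) / 2"
proof -
  have "0 \<le> (d * t - y)\<^sup>2 / d" using assms by simp
  also have "\<dots> = d * t\<^sup>2 - 2 * (t * y) + y\<^sup>2 / d"
    using assms by (simp add: power2_eq_square field_simps)
  finally show ?thesis by simp
qed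

text \<open>The bound \<open>|sin t| \<le> t\<close> cancels \<open>ln k\<close>, so a term costs
  order \<open>h * mangoldt k\<close>, free of \<open>W\<close>.\<close>

lemma mangoldt_term_le_small:
  assumes "2 \<le> k" "0 < h"
  shows "\<bar>mangoldt k / (sqrt (real k) * ln (real k)) * sin (h / 2 * ln (real k))\<bar> * x * y
    \<le> h / 4 * mangoldt k * (x\<^sup>2 + y\<^sup>2)"
proof -
  have ln: "0 < ln (real k)" and sq: "1 \<le> sqrt (real k)" using assms by auto
  have "\<bar>sin (h / 2 * ln (real k))\<bar> \<le> h / 2 * ln (real k)"
    using abs_sin_x_le_abs_x[of "h / 2 * ln (real k)"] assms ln by simp
  also have "\<dots> \<le> h / 2 * (sqrt (real k) * ln (real k))"
    using assms ln sq by (intro mult_left_mono) auto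
  finally have "\<bar>sin (h / 2 * ln (real k))\<bar> / (sqrt (real k) * ln (real k)) \<le> h / 2"
    using ln sq by (simp add: divide_le_eq)
  then have "mangoldt k * (\<bar>sin (h / 2 * ln (real k))\<bar> / (sqrt (real k) * ln (real k))) \<le> mangoldt k * (h / 2)"
    by (intro mult_left_mono mangoldt_nonneg)
  then have c: "\<bar>mangoldt k / (sqrt (real k) * ln (real k)) * sin (h / 2 * ln (real k))\<bar> \<le> mangoldt k * (h / 2)"
    using ln by (simp add: abs_mult)
  have "\<bar>x * y\<bar> \<le> (x\<^sup>2 + y\<^sup>2) / 2"
    using weighted_am_gm[of 1 "\<bar>x\<bar>" "\<bar>y\<bar>"] by (simp add: abs_mult)
  with c have "\<bar>mangoldt k / (sqrt (real k) * ln (real k)) * sin (h / 2 * ln (real k))\<bar> * \<bar>x * y\<bar>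
      \<le> mangoldt k * (h / 2) * ((x\<^sup>2 + y\<^sup>2) / 2)"
    using assms by (intro mult_mono mult_nonneg_nonneg mangoldt_nonneg) auto
  moreover have "\<bar>mangoldt k / (sqrt (real k) * ln (real k)) * sin (h / 2 * ln (real k))\<bar> * (x * y)
      \<le> \<bar>mangoldt k / (sqrt (real k) * ln (real k)) * sin (h / 2 * ln (real k))\<bar> * \<bar>x * y\<bar>"
    by (intro mult_left_mono) auto
  ultimately show ?thesis by (simp add: algebra_simps)
qed

text \<open>The weight leaves only \<open>mangoldt k\<close> beside \<open>y^2\<close>, ready for a
  divisor sum, and moves the kernel to \<open>x^2\<close>. Using the parameter
  \<open>sqrt W / h\<close> on the product \<open>u * x\<close> avoids dividing by \<open>u\<close>,
  which may vanish.\<close>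

lemma mangoldt_term_le_weighted:
  assumes "2 \<le> k" "0 < h" "0 < W"
  shows "\<bar>mangoldt k / (sqrt (real k) * ln (real k)) * sin (h / 2 * ln (real k))\<bar> * x * y
    \<le> sqrt W / (2 * h) * (mangoldt k / real k * (sin (h / 2 * ln (real k)) / ln (real k))\<^sup>2) * x\<^sup>2
      + h / (2 * sqrt W) * mangoldt k * y\<^sup>2"
proof -
  define u where "u = \<bar>sin (h / 2 * ln (real k))\<bar> / (sqrt (real k) * ln (real k))"
  have "0 < ln (real k)" using assms by simp
  then have "\<bar>mangoldt k / (sqrt (real k) * ln (real k)) * sin (h / 2 * ln (real k))\<bar> * x * y
      = mangoldt k * (u * x * y)"
    by (simp add: u_def abs_mult)
  also have "\<dots> \<le> mangoldt k * ((sqrt W / h * (u * x)\<^sup>2 + y\<^sup>2 / (sqrt W / h)) / 2)"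
    using assms by (intro mult_left_mono weighted_am_gm mangoldt_nonneg) auto
  also have "u\<^sup>2 = (sin (h / 2 * ln (real k)) / ln (real k))\<^sup>2 / real k"
    by (simp add: u_def power_divide power_mult_distrib)
  then have "(u * x)\<^sup>2 = (sin (h / 2 * ln (real k)) / ln (real k))\<^sup>2 / real k * x\<^sup>2"
    by (simp add: power_mult_distrib)
  finally show ?thesis by (simp add: algebra_simps add_divide_distrib)
qed

lemma mangoldt_sum_le_weighted:
  assumes "K > 1" "0 < h" "0 < W"
  shows "cmod (mangoldt_sum (h / 2) f L)
    \<le> (\<Sum>l | 1 \<le> l \<and> real l \<le> L. (cmod (f l))\<^sup>2 *
        (h / 2 * (\<Sum>k=1..K. mangoldt k)
         + sqrt W / (2 * h) * (\<Sum>k | K < k \<and> real k \<le> L / real l.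
              mangoldt k / real k * (sin (h / 2 * ln (real k)) / ln (real k))\<^sup>2)
         + h / (2 * sqrt W) * ln (real l)))"
proof -
  define A where "A = {(k, m). 2 \<le> k \<and> 1 \<le> m \<and> real (k * m) \<le> L}"
  define S where "S = {l. 1 \<le> l \<and> real l \<le> L}"
  define g where "g k = mangoldt k / real k * (sin (h / 2 * ln (real k)) / ln (real k))\<^sup>2" for k
  define B where "B = (\<Sum>k=1..K. mangoldt k :: real)"
  \<comment> \<open>\<open>F\<close> collects what is charged to \<open>|f(m)|^2\<close> and
    \<open>G\<close> what is charged to \<open>|f(k * m)|^2\<close>. The last term of
    \<open>G\<close> is kept for all \<open>k\<close>, so that its divisor sum is complete.\<close>
  define F where "F k m = (cmod (f m))\<^sup>2 *
    ((if k \<le> K then h / 4 * mangoldt k else 0) + (if K < k then sqrt W / (2 * h) * g k else 0))" for k m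
  define G where "G k l = (cmod (f l))\<^sup>2 *
    ((if k \<le> K then h / 4 * mangoldt k else 0) + h / (2 * sqrt W) * mangoldt k)" for k l
  have g: "0 \<le> g k" for k by (simp add: g_def mangoldt_nonneg)
  have "cmod (mangoldt_sum (h / 2) f L)
    \<le> (\<Sum>(k, m)\<in>A. \<bar>mangoldt k / (sqrt (real k) * ln (real k)) * sin (h / 2 * ln (real k))\<bar>
        * cmod (f m) * cmod (f (k * m)))"
    unfolding mangoldt_sum_def A_def
    by (rule order_trans[OF norm_sum])
       (auto intro!: sum_mono simp: norm_mult norm_divide abs_mult simp flip: of_real_mult of_real_divide)
  also have "\<dots> \<le> (\<Sum>(k, m)\<in>A. F k m + G k (k * m))"
  proof (rule sum_mono, clarify)
    fix k m assume "(k, m) \<in> A"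
    then have k: "2 \<le> k" by (auto simp: A_def)
    show "\<bar>mangoldt k / (sqrt (real k) * ln (real k)) * sin (h / 2 * ln (real k))\<bar>
        * cmod (f m) * cmod (f (k * m)) \<le> F k m + G k (k * m)"
    proof (cases "k \<le> K")
      case True
      have "0 \<le> (cmod (f (k * m)))\<^sup>2 * (h / (2 * sqrt W) * mangoldt k)"
        using assms by (intro mult_nonneg_nonneg mangoldt_nonneg) auto
      then show ?thesis
        using mangoldt_term_le_small[OF k assms(2), of "cmod (f m)" "cmod (f (k * m))"] True
        by (simp add: F_def G_def algebra_simps)
    next
      case False
      then show ?thesis
        using mangoldt_term_le_weighted[OF k assms(2,3), of "cmod (f m)" "cmod (f (k * m))"]
        by (simp add: F_def G_def g_def algebra_simps)
    qed
  qed
  also have "\<dots> = (\<Sum>(k, m)\<in>A. F k m) + (\<Sum>(k, m)\<in>A. G k (k * m))"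
    by (simp add: sum.distrib case_prod_unfold)
  also have "(\<Sum>(k, m)\<in>A. F k m) = (\<Sum>m\<in>S. \<Sum>k | 2 \<le> k \<and> real k \<le> L / real m. F k m)"
    unfolding A_def S_def by (rule sum_pairs_by_cofactor)
  also have "(\<Sum>(k, m)\<in>A. G k (k * m)) = (\<Sum>l\<in>S. \<Sum>k | 2 \<le> k \<and> k dvd l. G k l)"
    unfolding A_def S_def by (rule sum_pairs_by_product)
  also have "(\<Sum>m\<in>S. \<Sum>k | 2 \<le> k \<and> real k \<le> L / real m. F k m) + (\<Sum>l\<in>S. \<Sum>k | 2 \<le> k \<and> k dvd l. G k l)
    = (\<Sum>l\<in>S. (\<Sum>k | 2 \<le> k \<and> real k \<le> L / real l. F k l) + (\<Sum>k | 2 \<le> k \<and> k dvd l. G k l))"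
    by (simp add: sum.distrib)
  also have "\<dots> \<le> (\<Sum>l\<in>S. (cmod (f l))\<^sup>2 *
      (h / 2 * B + sqrt W / (2 * h) * (\<Sum>k | K < k \<and> real k \<le> L / real l. g k) + h / (2 * sqrt W) * ln (real l)))"
  proof (rule sum_mono)
    fix l assume "l \<in> S"
    then have l: "1 \<le> l" by (simp add: S_def)
    \<comment> \<open>Applied to both groupings, so the small \<open>k\<close> contribute
      \<open>h / 4 * B\<close> twice.\<close>
    have small: "(\<Sum>k\<in>X. if k \<le> K then h / 4 * mangoldt k else 0) \<le> h / 4 * B" if "finite X" "X \<subseteq> {2..}" for X
    proof -
      have "(\<Sum>k\<in>X. if k \<le> K then h / 4 * mangoldt k else 0) = (\<Sum>k | k \<in> X \<and> k \<le> K. h / 4 * mangoldt k)"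
        by (rule sum.inter_filter[symmetric]) fact
      also have "\<dots> \<le> (\<Sum>k=1..K. h / 4 * mangoldt k)"
        using that assms by (intro sum_mono2) (auto simp: mangoldt_nonneg)
      finally show ?thesis by (simp add: B_def sum_distrib_left)
    qed
    have fin: "finite {k. 2 \<le> k \<and> real k \<le> L / real l}" "finite {k. 2 \<le> k \<and> k dvd l}"
      using l by (auto intro: finite_nat_le_real)
    have "(\<Sum>k | 2 \<le> k \<and> real k \<le> L / real l. if K < k then sqrt W / (2 * h) * g k else 0)
        = (\<Sum>k | K < k \<and> real k \<le> L / real l. sqrt W / (2 * h) * g k)"
      unfolding sum.inter_filter[OF fin(1), symmetric] using assms by (intro sum.cong) auto
    then have F: "(\<Sum>k | 2 \<le> k \<and> real k \<le> L / real l. F k l)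
        \<le> (cmod (f l))\<^sup>2 * (h / 4 * B + sqrt W / (2 * h) * (\<Sum>k | K < k \<and> real k \<le> L / real l. g k))"
      unfolding F_def sum_distrib_left[symmetric] sum.distrib
      using small[OF fin(1)] by (intro mult_left_mono) (auto simp: sum_distrib_left)
    \<comment> \<open>Only the divisor 1 is missing, where the von Mangoldt function
      vanishes.\<close>
    have "(\<Sum>k | 2 \<le> k \<and> k dvd l. mangoldt k) = (\<Sum>k | k dvd l. mangoldt k :: real)"
    proof (intro sum.mono_neutral_left ballI)
      show "finite {k. k dvd l}" using l by auto
      fix k assume k: "k \<in> {k. k dvd l} - {k. 2 \<le> k \<and> k dvd l}"
      then have "k = 1" using l dvd_pos_nat[of l k] by auto
      then show "mangoldt k = (0 :: real)" by simp
    qed auto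
    also have "\<dots> = ln (real l)"
      using mangoldt_sum[of l, where ?'a = real] l by simp
    finally have G: "(\<Sum>k | 2 \<le> k \<and> k dvd l. G k l)
        \<le> (cmod (f l))\<^sup>2 * (h / 4 * B + h / (2 * sqrt W) * ln (real l))"
      unfolding G_def sum_distrib_left[symmetric] sum.distrib
      using small[OF fin(2)] by (intro mult_left_mono) (auto simp: sum_distrib_left)
    from F G show "(\<Sum>k | 2 \<le> k \<and> real k \<le> L / real l. F k l) + (\<Sum>k | 2 \<le> k \<and> k dvd l. G k l)
      \<le> (cmod (f l))\<^sup>2 * (h / 2 * B + sqrt W / (2 * h) * (\<Sum>k | K < k \<and> real k \<le> L / real l. g k)
          + h / (2 * sqrt W) * ln (real l))"
      by (simp add: algebra_simps)
  qed
  finally show ?thesis by (simp only: S_def B_def g_def)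
qed

text \<open>After division by \<open>mass f L\<close> the bound is an average over \<open>l\<close>
  with weights \<open>|f(l)|^2\<close>, hence at most the maximum. The small \<open>k\<close> give
  the constant \<open>B / pi\<close>, absolute because \<open>K\<close> is.\<close>

theorem mangoldt_sum_bound:
  obtains C where "\<And>f L h W. (\<exists>n. 1 \<le> n \<and> real n \<le> L \<and> f n \<noteq> 0) \<Longrightarrow> 0 < h \<Longrightarrow> 0 < W \<Longrightarrow>
    \<bar>Re (complex_of_real (2 / pi) * mangoldt_sum (h / 2) f L)\<bar> / mass f L
      \<le> (MAX l\<in>{l. 1 \<le> l \<and> real l \<le> L}.
            sqrt W / 2 * phi (h / (2 * pi) * ln (L / real l)) + h * ln (real l) / (pi * sqrt W)) + C * h"
proof -
  obtain K where K: "K > 1" and tail: "\<And>h X. 0 < h \<Longrightarrow> 1 \<le> X \<Longrightarrow>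
      (\<Sum>k | K < k \<and> real k \<le> X. mangoldt k / real k * (sin (h / 2 * ln (real k)) / ln (real k))\<^sup>2)
      \<le> pi * h / 2 * phi (h / (2 * pi) * ln X)"
    by (rule mangoldt_tail_le_phi) blast
  define B where "B = (\<Sum>k=1..K. mangoldt k :: real)"
  have "\<bar>Re (complex_of_real (2 / pi) * mangoldt_sum (h / 2) f L)\<bar> / mass f L
      \<le> (MAX l\<in>{l. 1 \<le> l \<and> real l \<le> L}.
            sqrt W / 2 * phi (h / (2 * pi) * ln (L / real l)) + h * ln (real l) / (pi * sqrt W)) + B / pi * h"
    if f: "\<exists>n. 1 \<le> n \<and> real n \<le> L \<and> f n \<noteq> 0" and h: "0 < h" and W: "0 < W" for f L h W
  proof -
    define S where "S = {l. 1 \<le> l \<and> real l \<le> L}"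
    define R where "R l = sqrt W / 2 * phi (h / (2 * pi) * ln (L / real l)) + h * ln (real l) / (pi * sqrt W)" for l
    define M where "M = (MAX l\<in>S. R l)"
    have S: "finite S" unfolding S_def by (rule finite_nat_le_real)
    have mass: "mass f L = (\<Sum>l\<in>S. (cmod (f l))\<^sup>2)"
      by (simp add: mass_def S_def)
    have "0 < mass f L"
      unfolding mass using f S by (auto simp: S_def intro!: sum_pos2)
    have "\<bar>Re (complex_of_real (2 / pi) * mangoldt_sum (h / 2) f L)\<bar>
        = 2 / pi * \<bar>Re (mangoldt_sum (h / 2) f L)\<bar>"
      by (simp add: abs_mult)
    also have "\<dots> \<le> 2 / pi * cmod (mangoldt_sum (h / 2) f L)"
      by (intro mult_left_mono abs_Re_le_cmod) auto
    also have "\<dots> \<le> 2 / pi * (\<Sum>l\<in>S. (cmod (f l))\<^sup>2 *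
        (h / 2 * B
         + sqrt W / (2 * h) * (\<Sum>k | K < k \<and> real k \<le> L / real l.
              mangoldt k / real k * (sin (h / 2 * ln (real k)) / ln (real k))\<^sup>2)
         + h / (2 * sqrt W) * ln (real l)))"
      unfolding S_def B_def by (intro mult_left_mono mangoldt_sum_le_weighted K h W) auto
    also have "\<dots> \<le> 2 / pi * (\<Sum>l\<in>S. (cmod (f l))\<^sup>2 * (pi / 2 * (M + B / pi * h)))"
    proof (intro mult_left_mono sum_mono)
      fix l assume l: "l \<in> S"
      have "sqrt W / (2 * h) * (\<Sum>k | K < k \<and> real k \<le> L / real l.
              mangoldt k / real k * (sin (h / 2 * ln (real k)) / ln (real k))\<^sup>2)
          \<le> sqrt W / (2 * h) * (pi * h / 2 * phi (h / (2 * pi) * ln (L / real l)))"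
        \<comment> \<open>The tail bound applies with \<open>X = L / l\<close>, which is at least 1
          because \<open>l \<le> L\<close>.\<close>
        using l h W by (intro mult_left_mono tail) (auto simp: S_def)
      also have "\<dots> = pi / 2 * (sqrt W / 2 * phi (h / (2 * pi) * ln (L / real l)))"
        using h by simp
      finally have *: "sqrt W / (2 * h) * (\<Sum>k | K < k \<and> real k \<le> L / real l.
              mangoldt k / real k * (sin (h / 2 * ln (real k)) / ln (real k))\<^sup>2)
          \<le> pi / 2 * (sqrt W / 2 * phi (h / (2 * pi) * ln (L / real l)))" .
      have "h / (2 * sqrt W) * ln (real l) = pi / 2 * (h * ln (real l) / (pi * sqrt W))"
        "h / 2 * B = pi / 2 * (B / pi * h)" by simp_all
      with * have "h / 2 * B
         + sqrt W / (2 * h) * (\<Sum>k | K < k \<and> real k \<le> L / real l.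
              mangoldt k / real k * (sin (h / 2 * ln (real k)) / ln (real k))\<^sup>2)
         + h / (2 * sqrt W) * ln (real l) \<le> pi / 2 * (R l + B / pi * h)"
        unfolding R_def distrib_left by linarith
      also have "R l \<le> M"
        unfolding M_def using S l by (intro Max_ge) auto
      finally show "h / 2 * B
         + sqrt W / (2 * h) * (\<Sum>k | K < k \<and> real k \<le> L / real l.
              mangoldt k / real k * (sin (h / 2 * ln (real k)) / ln (real k))\<^sup>2)
         + h / (2 * sqrt W) * ln (real l) \<le> pi / 2 * (M + B / pi * h)"
        by simp
    qed auto
    also have "\<dots> = (M + B / pi * h) * mass f L"
      unfolding mass sum_distrib_right[symmetric] by simp
    finally show ?thesis
      unfolding M_def R_def S_def by (subst pos_divide_le_eq[OF \<open>0 < mass f L\<close>])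
  qed
  then show thesis using that by blast
qed

text \<open>Choosing the constants before \<open>f\<close>, \<open>L\<close>, \<open>h\<close>,
  \<open>T\<close>, \<open>\<xi>\<close> and \<open>W\<close> makes them absolute. A nonzero value
  of \<open>f\<close> on \<open>[1, L]\<close> makes the denominator positive.\<close>

theorem theorem3:
  shows "(\<exists>C L0 :: real. \<forall>(f :: nat \<Rightarrow> complex) (L :: real) (h :: real) (W :: real).
            L \<ge> L0 \<longrightarrow> (\<exists>n. 1 \<le> n \<and> real n \<le> L \<and> f n \<noteq> 0) \<longrightarrow> h > 0 \<longrightarrow> W > 0 \<longrightarrow>
            \<bar>Re (complex_of_real (2 / pi) * mangoldt_sum (h / 2) f L)\<bar> / mass f L
              \<le> (MAX l\<in>{l :: nat. 1 \<le> l \<and> real l \<le> L}.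
                    sqrt W / 2 * phi (h / (2 * pi) * ln (L / real l))
                      + h * ln (real l) / (pi * sqrt W))
                + C * h)
       \<and> (\<exists>C L0 T0 :: real. \<forall>(f :: nat \<Rightarrow> complex) (L :: real) (T :: real) (\<xi> :: real) (W :: real).
            L \<ge> L0 \<longrightarrow> T \<ge> T0 \<longrightarrow> (\<exists>n. 1 \<le> n \<and> real n \<le> L \<and> f n \<noteq> 0) \<longrightarrow> \<xi> > 0 \<longrightarrow> W > 0 \<longrightarrow>
            \<bar>tau T L \<xi> f - \<xi>\<bar>
              \<le> (MAX l\<in>{l :: nat. 1 \<le> l \<and> real l \<le> L}.
                    sqrt W / 2 * phi (\<xi> * (ln (L / real l) / ln T))
                      + 2 * \<xi> / sqrt W * (ln (real l) / ln T))
                + C * (\<xi> / ln T))"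
proof -
  obtain C where C: "\<And>f L h W. (\<exists>n. 1 \<le> n \<and> real n \<le> L \<and> f n \<noteq> 0) \<Longrightarrow> 0 < h \<Longrightarrow> 0 < W \<Longrightarrow>
    \<bar>Re (complex_of_real (2 / pi) * mangoldt_sum (h / 2) f L)\<bar> / mass f L
      \<le> (MAX l\<in>{l. 1 \<le> l \<and> real l \<le> L}.
            sqrt W / 2 * phi (h / (2 * pi) * ln (L / real l)) + h * ln (real l) / (pi * sqrt W)) + C * h"
    by (rule mangoldt_sum_bound) blast
  show ?thesis
  proof (rule conjI, goal_cases)
    case 1
    show ?case
      using C by blast
  next
    case 2
    show ?case
    proof (rule exI[of _ "2 * pi * C"], rule exI[of _ 1], rule exI[of _ 2], intro allI impI)
      fix f :: "nat \<Rightarrow> complex" and L T \<xi> W :: real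
      assume f: "\<exists>n. 1 \<le> n \<and> real n \<le> L \<and> f n \<noteq> 0" and T: "2 \<le> T" and \<xi>: "0 < \<xi>" and W: "0 < W"
      \<comment> \<open>With this \<open>h\<close>, \<open>h / 2\<close> is the angle in
        \<open>tau\<close>, \<open>h / (2 * pi)\<close> is \<open>\<xi> / ln T\<close>, and
        \<open>C * h\<close> becomes the stated error; \<open>T \<ge> 2\<close> keeps
        \<open>ln T\<close> positive.\<close>
      define h where "h = 2 * pi * \<xi> / ln T"
      have lnT: "0 < ln T" using T by simp
      have h: "0 < h" using lnT \<xi> by (simp add: h_def)
      have "mass f L \<ge> 0" unfolding mass_def by (intro sum_nonneg) simp
      then have "\<bar>tau T L \<xi> f - \<xi>\<bar> = \<bar>Re (complex_of_real (2 / pi) * mangoldt_sum (h / 2) f L)\<bar> / mass f L"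
        by (simp add: tau_def h_def abs_divide)
      also note C[OF f h W]
      also have "(\<lambda>l. sqrt W / 2 * phi (h / (2 * pi) * ln (L / real l)) + h * ln (real l) / (pi * sqrt W))
        = (\<lambda>l. sqrt W / 2 * phi (\<xi> * (ln (L / real l) / ln T)) + 2 * \<xi> / sqrt W * (ln (real l) / ln T))"
        using lnT W by (simp add: h_def fun_eq_iff field_simps)
      also have "C * h = 2 * pi * C * (\<xi> / ln T)"
        by (simp add: h_def)
      finally show "\<bar>tau T L \<xi> f - \<xi>\<bar>
              \<le> (MAX l\<in>{l :: nat. 1 \<le> l \<and> real l \<le> L}.
                    sqrt W / 2 * phi (\<xi> * (ln (L / real l) / ln T))
                      + 2 * \<xi> / sqrt W * (ln (real l) / ln T))
                + 2 * pi * C * (\<xi> / ln T)" .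
    qed
  qed
qed

end
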